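(* Let $\{x_{i,k}\}$, $i\in\{1,\dots,m\}$, $k\ge 1$, be generated by the distributed proximal gradient algorithm described in the context, with arbitrary initial points $x_{i,1}\in\mathbb{R}^n$, and suppose that the problem assumptions (P-a)–(P-e) and the network assumptions (N-a)–(N-c) of the context hold. Let $\bar x_k=\frac1m\sum_{i=1}^m x_{i,k}$ for $k\ge1$ and $\bar x_0:=\bar x_1$. Then $$\frac1T\sum_{k=1}^T\|\bar x_k-\bar x_{k-1}\|^2=O\Big(\frac1T\Big)\quad\text{as }T\to\infty .$$
   Context: **Problem.** There are $m$ agents. Consider $\min_{x\in\mathbb{R}^n} f(x)=\frac1m\sum_{i=1}^m\big(g_i(x)+h(x)\big)$, where $g_i:\mathbb{R}^n\to\mathbb{R}$ is differentiable (possibly non-convex) and $h:\mathbb{R}^n\to(-\infty,\infty]$ is closed, proper, convex and possibly non-smooth. $\|\cdot\|$ is the Euclidean norm. **Problem assumptions.** (P-a) Each $g_i$ is continuously differentiable and $\|\nabla g_i(x)-\nabla g_i(y)\|\le L\|x-y\|$ for all $x,y$, with a common constant $L>0$. (P-b) $h$ is convex. (P-c) There is a scalar $G_g$ with $\|\nabla g_i(x)\|<G_g$ for all $i$ and all $x$. (P-d) There is a scalar $G_h$ with $\|z\|<G_h$ for every $x$ and every subgradient $z\in\partial h(x)$. (P-e) The problem has at least one optimal solution $x^*$. **Network.** At each time $t=1,2,\dots$ the agents communicate over an undirected graph with vertex set $\{1,\dots,m\}$, edge set $\mathcal{E}(t)$ and symmetric adjacency (weight) matrix $A(t)=[a_{ij}(t)]\in\mathbb{R}^{m\times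 m}$. **Network assumptions.** (N-a) Each $A(t)$ is doubly stochastic. (N-b) There is $\eta\in(0,1)$ such that $a_{ii}(t)\ge\eta$ for all $i,t$; and for $i\neq j$, $a_{ij}(t)\ge\eta$ if $\{i,j\}\in\mathcal{E}(t)$ and $a_{ij}(t)=0$ otherwise. (N-c) The graph sequence is uniformly connected: each agent $j$ receives information from each agent $i$ for infinitely many $t$, and there is an integer $B\ge1$ such that each agent $i$ sends its information to all other agents at least once every $B$ consecutive time slots (i.e. for all $i\ne j$ and all $t$, $\{i,j\}\in\mathcal{E}(s)$ for some $s\in\{t,\dots,t+B-1\}$). **Proximal operator.** For $\alpha>0$, $\mathrm{prox}_{\alpha,h}(x)=\mathrm{argmin}_{z\in\mathbb{R}^n}\{h(z)+\frac{1}{2\alpha}\|z-x\|^2\}$. **Algorithm.** Fix a constant step-size $0<\alpha<\frac1L$. For $i\in\{1,\dots,m\}$ and $k=1,2,\dots$: $$q_{i,k+1}=x_{i,k}-\alpha\nabla g_i(x_{i,k}),\qquad v_{i,k+1}=\sum_{j=1}^m\lambda_{ij,k+1}\,q_{j,k+1},\qquad x_{i,k+1}=\mathrm{prox}_{\alpha,h}(v_{i,k+1}),$$ where $\lambda_{ij,k}=\big[\Phi(t(k)+k,t(k))\big]_{ij}$, $\Phi(t,s)=A(t)A(t-1)\cdots A(s+1)A(s)$ for $t>s\ge0$, and $t(k)$ is the total number of communication steps before iteration $k$; since $k$ communication steps are performed at iteration $k$, $t(k)=\sum_{l=1}^{k-1}l=\frac{k(k-1)}2$. *)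

theory Defs
  imports "HOL-Analysis.Analysis" "HOL-Library.Landau_Symbols"
begin

text \<open>
  Extended-real-valued functions on a Euclidean space. Convexity and closedness of
  \<open>h\<close> mean that the epigraph, taken inside \<open>'a \<times> real\<close>, is convex resp. closed.
\<close>

definition epi :: "('a \<Rightarrow> ereal) \<Rightarrow> ('a \<times> real) set" where
  "epi h = {(x, r). h x \<le> ereal r}"

definition proper_fun :: "('a \<Rightarrow> ereal) \<Rightarrow> bool" where
  "proper_fun h \<longleftrightarrow> (\<forall>x. h x \<noteq> -\<infinity>) \<and> (\<exists>x. h x \<noteq> \<infinity>)"

definition convex_fun :: "('a::real_vector \<Rightarrow> ereal) \<Rightarrow> bool" where
  "convex_fun h \<longleftrightarrow> convex (epi h)"

definition closed_fun :: "('a::topological_space \<Rightarrow> ereal) \<Rightarrow> bool" where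
  "closed_fun h \<longleftrightarrow> closed (epi h)"

text \<open>
  For proper \<open>h\<close> this is empty at every point where \<open>h\<close> is infinite.
\<close>

definition subdifferential :: "('a::real_inner \<Rightarrow> ereal) \<Rightarrow> 'a \<Rightarrow> 'a set" where
  "subdifferential h x = {z. \<forall>y. h x + ereal (z \<bullet> (y - x)) \<le> h y}"

text \<open>
  The minimiser exists and is unique when \<open>h\<close> is closed, proper and convex and
  \<open>\<alpha> > 0\<close>, so the choice made by \<open>arg_min\<close> is then immaterial.
\<close>

definition prox :: "real \<Rightarrow> ('a::real_inner \<Rightarrow> ereal) \<Rightarrow> 'a \<Rightarrow> 'a" where
  "prox \<alpha> h x = (ARG_MIN (\<lambda>z. h z + ereal (1 / (2 * \<alpha>) * (norm (z - x))\<^sup>2)) z. True)"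

definition objective :: "('m::finite \<Rightarrow> 'a \<Rightarrow> real) \<Rightarrow> ('a \<Rightarrow> ereal) \<Rightarrow> 'a \<Rightarrow> ereal" where
  "objective g h x = ereal (1 / real CARD('m)) * (\<Sum>i\<in>UNIV. ereal (g i x) + h x)"

definition doubly_stochastic :: "real ^ 'm ^ 'm \<Rightarrow> bool" where
  "doubly_stochastic M \<longleftrightarrow> (\<forall>i j. 0 \<le> M $ i $ j) \<and>
     (\<forall>i. (\<Sum>j\<in>UNIV. M $ i $ j) = 1) \<and> (\<forall>j. (\<Sum>i\<in>UNIV. M $ i $ j) = 1)"

text \<open>
  \<open>Phi A t s\<close> is the product \<open>A t ** A (t - 1) ** \<dots> ** A s\<close> for \<open>s \<le> t\<close>, and the
  identity matrix for \<open>t < s\<close>.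
\<close>

primrec Phi :: "(nat \<Rightarrow> real ^ 'm ^ 'm) \<Rightarrow> nat \<Rightarrow> nat \<Rightarrow> real ^ 'm ^ 'm" where
  "Phi A 0 s = (if s = 0 then A 0 else mat 1)"
| "Phi A (Suc t) s = (if s \<le> Suc t then A (Suc t) ** Phi A t s else mat 1)"

definition comm_steps :: "nat \<Rightarrow> nat" where
  "comm_steps k = (\<Sum>l = 1..k - 1. l)"

definition mix_weight :: "(nat \<Rightarrow> real ^ 'm ^ 'm) \<Rightarrow> 'm \<Rightarrow> 'm \<Rightarrow> nat \<Rightarrow> real" where
  "mix_weight A i j k = Phi A (comm_steps k + k) (comm_steps k) $ i $ j"

definition xbar :: "('m::finite \<Rightarrow> nat \<Rightarrow> 'a::real_vector) \<Rightarrow> nat \<Rightarrow> 'a" where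
  "xbar x k = (if k = 0 then (1 / real CARD('m)) *\<^sub>R (\<Sum>i\<in>UNIV. x i 1)
               else (1 / real CARD('m)) *\<^sub>R (\<Sum>i\<in>UNIV. x i k))"

end

theory Submission
  imports Defs
begin

text \<open>
  Bounded subgradients force \<open>h\<close> to be finite and Lipschitz: the prox points \<open>prox \<alpha> h v\<close> lie
  within \<open>\<alpha> G_h\<close> of \<open>v\<close>, so they tend to \<open>v\<close> as \<open>\<alpha> \<rightarrow> 0\<close>, and closedness passes the subgradient
  inequality to the limit.

  Any two agents talk within \<open>B\<close> steps, so every product of \<open>B\<close> weight matrices has all entries at
  least \<open>\<eta> ^ B\<close> and contracts deviations from the mean by \<open>1 - \<eta> ^ B\<close>. The iterates grow at
  most linearly while iteration \<open>k\<close> mixes over more than \<open>k\<close> steps, hence the disagreement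
  \<open>e k\<close> of the \<open>v i (k + 1)\<close> is summable. Up to errors of order \<open>e\<close>, the average thus follows the
  centralised proximal gradient method, for which the objective decreases by a multiple of the
  squared step length; telescoping against the optimal value makes the squared steps summable.
\<close>

section \<open>Proximal operator\<close>

lemma mem_epi: "(x, r) \<in> epi h \<longleftrightarrow> h x \<le> ereal r"
  by (simp add: epi_def)

text \<open>Separate the closed convex epigraph from the point \<open>(x0, r0 - 1)\<close> just
  below it. As \<open>(x0, r0)\<close> belongs to the epigraph, the hyperplane is not vertical
  (\<open>c > 0\<close>) and can be solved for the last coordinate.\<close>

lemma affine_minorant:
  fixes h :: "'a::euclidean_space \<Rightarrow> ereal"
  assumes "closed_fun h" "proper_fun h" "convex_fun h"
  obtains a b where "\<And>y. ereal (a \<bullet> y + b) \<le> h y"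
proof -
  obtain x0 where "h x0 \<noteq> \<infinity>" "h x0 \<noteq> -\<infinity>"
    using assms by (auto simp: proper_fun_def)
  then obtain r0 where r0: "h x0 = ereal r0" by (cases "h x0") auto
  have "(x0, r0 - 1) \<notin> epi h" by (simp add: mem_epi r0)
  then obtain u \<beta> where u: "u \<bullet> (x0, r0 - 1) < \<beta>" "\<And>y. y \<in> epi h \<Longrightarrow> \<beta> < u \<bullet> y"
    using separating_hyperplane_closed_point[of "epi h"] assms
    unfolding closed_fun_def convex_fun_def by metis
  obtain a c where ac: "u = (a, c)" by (cases u)
  have "(x0, r0) \<in> epi h" by (simp add: mem_epi r0)
  from u(2)[OF this] u(1) have c: "c > 0" by (simp add: ac algebra_simps)
  have "ereal ((- (1 / c)) *\<^sub>R a \<bullet> y + \<beta> / c) \<le> h y" for y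
  proof (cases "h y")
    case (real r)
    then have "\<beta> < u \<bullet> (y, r)" by (intro u) (simp add: mem_epi)
    then have "\<beta> - a \<bullet> y < c * r" by (simp add: ac)
    then have "(\<beta> - a \<bullet> y) / c < r" using c by (simp add: divide_simps mult.commute)
    then show ?thesis using c real by (simp add: diff_divide_distrib)
  qed (use assms in \<open>auto simp: proper_fun_def\<close>)
  then show ?thesis by (rule that)
qed

text \<open>Minimising over the epigraph replaces \<open>h\<close>, which may be discontinuous or
  infinite, by the continuous function \<open>f\<close>. The sublevel set \<open>K\<close> is
  compact because the quadratic outgrows the affine minorant.\<close>

lemma prox_objective_attains_min:
  fixes h :: "'a::euclidean_space \<Rightarrow> ereal"
  assumes h: "closed_fun h" "proper_fun h" "convex_fun h" and c: "c > 0"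
  obtains p where "\<And>z. h p + ereal (c * (norm (p - v))\<^sup>2) \<le> h z + ereal (c * (norm (z - v))\<^sup>2)"
proof -
  obtain a b where ab: "\<And>y. ereal (a \<bullet> y + b) \<le> h y"
    using affine_minorant[OF h] by blast
  obtain y0 where "h y0 \<noteq> \<infinity>" "h y0 \<noteq> -\<infinity>"
    using h by (auto simp: proper_fun_def)
  then obtain r0 where r0: "h y0 = ereal r0" by (cases "h y0") auto
  define f where "f = (\<lambda>w::'a \<times> real. snd w + c * (norm (fst w - v))\<^sup>2)"
  define R where "R = f (y0, r0)"
  define K where "K = epi h \<inter> {w. f w \<le> R}"
  have cont: "continuous_on S f" for S
    unfolding f_def by (intro continuous_intros)
  have "closed K"
    unfolding K_def using h cont
    by (intro closed_Int closed_Collect_le continuous_on_const) (auto simp: closed_fun_def)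
  moreover have "bounded K"
  proof -
    \<comment> \<open>With \<open>n = norm (z - v)\<close>, points of \<open>K\<close> satisfy
      \<open>c * n\<^sup>2 \<le> Q + norm a * n\<close>. For \<open>n > 1\<close> the right side is
      at most \<open>(Q + norm a) * n\<close>, whence \<open>N\<close>.\<close>
    define Q where "Q = \<bar>R - b - a \<bullet> v\<bar>"
    define N where "N = max 1 ((Q + norm a) / c)"
    have N: "norm (z - v) \<le> N \<and> r \<in> {- (norm a * (N + norm v)) + b..R}" if "(z, r) \<in> K" for z r
    proof -
      have "h z \<le> ereal r" "f (z, r) \<le> R" using that by (auto simp: K_def mem_epi)
      then have 1: "a \<bullet> z + b \<le> r" and 2: "r + c * (norm (z - v))\<^sup>2 \<le> R"
        using order_trans[OF ab[of z], of "ereal r"] by (auto simp: f_def)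
      have 3: "\<bar>a \<bullet> (z - v)\<bar> \<le> norm a * norm (z - v)" by (rule Cauchy_Schwarz_ineq2)
      have 4: "c * (norm (z - v))\<^sup>2 \<le> Q + norm a * norm (z - v)"
        using 1 2 3 by (auto simp: Q_def inner_diff_right)
      have n: "norm (z - v) \<le> N"
      proof (cases "norm (z - v) \<le> 1")
        case False
        then have "Q * 1 \<le> Q * norm (z - v)" by (intro mult_left_mono) (auto simp: Q_def)
        with 4 have "c * norm (z - v) * norm (z - v) \<le> (Q + norm a) * norm (z - v)"
          by (simp add: power2_eq_square algebra_simps)
        then have "c * norm (z - v) \<le> Q + norm a"
          by (rule mult_right_le_imp_le) (use False in linarith)
        then have "norm (z - v) \<le> (Q + norm a) / c" using c by (simp add: field_simps)
        then show ?thesis by (simp add: N_def)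
      qed (simp add: N_def)
      have "norm z \<le> norm (z - v) + norm v" by (metis norm_triangle_sub add.commute)
      then have "norm a * norm z \<le> norm a * (N + norm v)"
        using n by (intro mult_left_mono) auto
      moreover have "\<bar>a \<bullet> z\<bar> \<le> norm a * norm z" by (rule Cauchy_Schwarz_ineq2)
      moreover have "c * (norm (z - v))\<^sup>2 \<ge> 0" using c by simp
      ultimately show ?thesis using n 1 2 by auto
    qed
    have "K \<subseteq> cball v N \<times> {- (norm a * (N + norm v)) + b..R}"
      using N by (auto simp: dist_norm norm_minus_commute)
    then show ?thesis
      by (rule bounded_subset[rotated]) (intro bounded_Times bounded_cball bounded_closed_interval)
  qed
  ultimately have "compact K" by (simp add: compact_eq_bounded_closed)
  moreover have y0K: "(y0, r0) \<in> K" by (simp add: K_def mem_epi r0 R_def)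
  ultimately obtain w where w: "w \<in> K" "\<And>w'. w' \<in> K \<Longrightarrow> f w \<le> f w'"
    using continuous_attains_inf[of K f] cont by blast
  obtain p r where pr: "w = (p, r)" by (cases w)
  have p: "h p \<le> ereal r" using w(1) by (simp add: K_def mem_epi pr)
  have "h p + ereal (c * (norm (p - v))\<^sup>2) \<le> h z + ereal (c * (norm (z - v))\<^sup>2)" for z
  proof (cases "h z")
    case (real s)
    have "f w \<le> f (z, s)"
    proof (cases "f (z, s) \<le> R")
      case True
      then show ?thesis by (intro w) (simp add: K_def mem_epi real)
    next
      case False
      then show ?thesis using w(2)[OF y0K] by (simp add: R_def)
    qed
    then have "ereal (r + c * (norm (p - v))\<^sup>2) \<le> h z + ereal (c * (norm (z - v))\<^sup>2)"
      by (simp add: f_def pr real)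
    moreover have "h p + ereal (c * (norm (p - v))\<^sup>2) \<le> ereal (r + c * (norm (p - v))\<^sup>2)"
      using add_right_mono[OF p, of "ereal (c * (norm (p - v))\<^sup>2)"] by simp
    ultimately show ?thesis by (rule order_trans[rotated])
  qed (use h in \<open>auto simp: proper_fun_def\<close>)
  then show ?thesis by (rule that)
qed

lemma prox_le:
  fixes h :: "'a::euclidean_space \<Rightarrow> ereal"
  assumes "closed_fun h" "proper_fun h" "convex_fun h" "\<alpha> > 0"
  shows "h (prox \<alpha> h v) + ereal (1 / (2 * \<alpha>) * (norm (prox \<alpha> h v - v))\<^sup>2)
         \<le> h z + ereal (1 / (2 * \<alpha>) * (norm (z - v))\<^sup>2)"
proof -
  let ?f = "\<lambda>z. h z + ereal (1 / (2 * \<alpha>) * (norm (z - v))\<^sup>2)"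
  have "1 / (2 * \<alpha>) > 0" using assms by simp
  then obtain p where "\<And>z. ?f p \<le> ?f z"
    using prox_objective_attains_min[OF assms(1-3)] by blast
  then have "is_arg_min ?f (\<lambda>_. True) p" by (auto simp: is_arg_min_def not_less)
  then have "is_arg_min ?f (\<lambda>_. True) (prox \<alpha> h v)"
    unfolding prox_def arg_min_def by (rule someI)
  then show ?thesis by (auto simp: is_arg_min_def not_less)
qed

lemma prox_finite:
  fixes h :: "'a::euclidean_space \<Rightarrow> ereal"
  assumes "closed_fun h" "proper_fun h" "convex_fun h" "\<alpha> > 0"
  obtains r where "h (prox \<alpha> h v) = ereal r"
proof -
  obtain y where "h y \<noteq> \<infinity>" using assms by (auto simp: proper_fun_def)
  then have "h (prox \<alpha> h v) \<noteq> \<infinity>"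
    using prox_le[OF assms, of v y] by auto
  moreover have "h (prox \<alpha> h v) \<noteq> -\<infinity>" using assms by (auto simp: proper_fun_def)
  ultimately show ?thesis using that by (cases "h (prox \<alpha> h v)") auto
qed

text \<open>Fermat's rule by hand: compare the minimiser \<open>p\<close> with points of the segment
  from \<open>p\<close> to \<open>y\<close>, bound \<open>h\<close> there by convexity, divide by
  the parameter \<open>t\<close> and let it tend to 0 from the right.\<close>

lemma prox_subgradient:
  fixes h :: "'a::euclidean_space \<Rightarrow> ereal"
  assumes h: "closed_fun h" "proper_fun h" "convex_fun h" "\<alpha> > 0"
  shows "(1 / \<alpha>) *\<^sub>R (v - prox \<alpha> h v) \<in> subdifferential h (prox \<alpha> h v)"
  unfolding subdifferential_def mem_Collect_eq
proof
  fix y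
  define p where "p = prox \<alpha> h v"
  define c where "c = 1 / (2 * \<alpha>)"
  have c: "c > 0" "2 * c = 1 / \<alpha>" using h by (auto simp: c_def)
  obtain r where r: "h p = ereal r" using prox_finite[OF h] unfolding p_def by blast
  show "h (prox \<alpha> h v) + ereal ((1 / \<alpha>) *\<^sub>R (v - prox \<alpha> h v) \<bullet> (y - prox \<alpha> h v)) \<le> h y"
    unfolding p_def[symmetric]
  proof (cases "h y")
    case (real s)
    \<comment> \<open>Half the derivative at \<open>t = 0\<close> of the squared distance from
      \<open>p + t *\<^sub>R (y - p)\<close> to \<open>v\<close>.\<close>
    define I where "I = (p - v) \<bullet> (y - p)"
    have *: "0 \<le> s - r + 2 * c * I + c * (norm (y - p))\<^sup>2 * t" if t: "0 < t" "t < 1" for t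
    proof -
      have "(1 - t) *\<^sub>R (p, r) + t *\<^sub>R (y, s) \<in> epi h"
        using h t by (intro convexD) (auto simp: convex_fun_def mem_epi r real)
      then have "h (p + t *\<^sub>R (y - p)) \<le> ereal ((1 - t) * r + t * s)"
        by (simp add: mem_epi algebra_simps)
      then have "h (p + t *\<^sub>R (y - p)) + ereal (c * (norm (p + t *\<^sub>R (y - p) - v))\<^sup>2)
          \<le> ereal ((1 - t) * r + t * s) + ereal (c * (norm (p + t *\<^sub>R (y - p) - v))\<^sup>2)"
        by (rule add_right_mono)
      with prox_le[OF h, of v "p + t *\<^sub>R (y - p)"]
      have "ereal r + ereal (c * (norm (p - v))\<^sup>2)
          \<le> ereal ((1 - t) * r + t * s) + ereal (c * (norm (p + t *\<^sub>R (y - p) - v))\<^sup>2)"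
        unfolding p_def[symmetric] c_def[symmetric] r by (rule order_trans)
      moreover have "(norm (p + t *\<^sub>R (y - p) - v))\<^sup>2
          = (norm (p - v))\<^sup>2 + 2 * t * I + t\<^sup>2 * (norm (y - p))\<^sup>2"
      proof -
        have "p + t *\<^sub>R (y - p) - v = (p - v) + t *\<^sub>R (y - p)" by simp
        then show ?thesis
          unfolding I_def power2_norm_eq_inner
          by (simp only: inner_add_left inner_add_right inner_scaleR_left inner_scaleR_right
              inner_commute[of "y - p" "p - v"] power2_eq_square) (simp add: algebra_simps)
      qed
      ultimately have "0 \<le> t * (s - r + 2 * c * I + c * (norm (y - p))\<^sup>2 * t)"
        by (simp add: algebra_simps power2_eq_square)
      then show ?thesis using t by (simp add: zero_le_mult_iff)
    qed
    have "((\<lambda>t. s - r + 2 * c * I + c * (norm (y - p))\<^sup>2 * t) \<longlongrightarrow>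
        s - r + 2 * c * I + c * (norm (y - p))\<^sup>2 * 0) (at_right 0)"
      by (intro tendsto_intros)
    moreover have "\<forall>\<^sub>F t in at_right 0. 0 \<le> s - r + 2 * c * I + c * (norm (y - p))\<^sup>2 * t"
      unfolding eventually_at_right_field using * by (intro exI[of _ 1]) auto
    ultimately have "0 \<le> s - r + 2 * c * I"
      using tendsto_lowerbound[of _ _ "at_right (0::real)" 0] by fastforce
    then have "r + (- (1 / \<alpha>) * I) \<le> s" using c by simp
    moreover have "(1 / \<alpha>) *\<^sub>R (v - p) \<bullet> (y - p) = - (1 / \<alpha>) * I"
      by (simp add: I_def inner_diff_left algebra_simps diff_divide_distrib)
    ultimately show "h p + ereal ((1 / \<alpha>) *\<^sub>R (v - p) \<bullet> (y - p)) \<le> h y"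
      by (simp only: r real plus_ereal.simps ereal_less_eq)
  qed (use h in \<open>auto simp: proper_fun_def\<close>)
qed

text \<open>Finiteness at \<open>v\<close> is part of the conclusion, so subgradients are taken at
  the prox points \<open>p n\<close> instead. There the subgradient inequality towards
  \<open>y\<close> and Cauchy-Schwarz give the bound, that is, a point of the closed epigraph, and
  these points converge as \<open>p n\<close> tends to \<open>v\<close>.\<close>

lemma Lipschitz_if_bounded_subgradients:
  fixes h :: "'a::euclidean_space \<Rightarrow> ereal"
  assumes h: "closed_fun h" "proper_fun h" "convex_fun h"
    and G: "\<And>y z. z \<in> subdifferential h y \<Longrightarrow> norm z \<le> G"
  shows "h v \<le> h y + ereal (G * norm (v - y))"
proof (cases "h y")
  case (real s)
  define p where "p n = prox (1 / real (Suc n)) h v" for n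
  define z where "z n = real (Suc n) *\<^sub>R (v - p n)" for n
  have sub: "z n \<in> subdifferential h (p n)" for n
    using prox_subgradient[OF h, of "1 / real (Suc n)" v] by (simp add: p_def z_def)
  have nz: "norm (z n) \<le> G" for n using G sub by blast
  have "norm (p n - v) \<le> G * (1 / real (Suc n))" for n
    using nz[of n] unfolding z_def norm_scaleR
    by (simp add: norm_minus_commute pos_le_divide_eq mult.commute del: of_nat_Suc)
  moreover have "(\<lambda>n. G * (1 / real (Suc n))) \<longlonglongrightarrow> G * 0"
    by (intro tendsto_mult tendsto_const LIMSEQ_Suc lim_1_over_n)
  ultimately have "(\<lambda>n. p n - v) \<longlonglongrightarrow> 0"
    by (intro Lim_null_comparison[of "\<lambda>n. p n - v"]) auto
  then have p: "p \<longlonglongrightarrow> v" by (rule LIM_zero_cancel)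
  have "(p n, s + G * norm (p n - y)) \<in> epi h" for n
  proof -
    obtain r where r: "h (p n) = ereal r"
      using prox_finite[OF h, of "1 / real (Suc n)" v] by (auto simp: p_def)
    have "r + z n \<bullet> (y - p n) \<le> s"
      using sub[of n] by (auto simp: subdifferential_def r real dest!: spec[of _ y])
    moreover have "- (z n \<bullet> (y - p n)) \<le> norm (z n) * norm (y - p n)"
      using Cauchy_Schwarz_ineq2[of "z n" "y - p n"] by linarith
    moreover have "norm (z n) * norm (y - p n) \<le> G * norm (y - p n)"
      by (intro mult_right_mono nz) auto
    ultimately show ?thesis by (simp add: mem_epi r norm_minus_commute)
  qed
  moreover have "(\<lambda>n. (p n, s + G * norm (p n - y))) \<longlonglongrightarrow> (v, s + G * norm (v - y))"
    by (intro tendsto_intros p)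
  ultimately have "(v, s + G * norm (v - y)) \<in> epi h"
    using closed_sequentially[OF h(1)[unfolded closed_fun_def],
        where f = "\<lambda>n. (p n, s + G * norm (p n - y))"] by simp
  then show ?thesis by (simp add: mem_epi real)
qed (use h in \<open>auto simp: proper_fun_def\<close>)

lemma subdifferential_monotone:
  assumes "u \<in> subdifferential h x" "w \<in> subdifferential h y"
    and "\<bar>h x\<bar> \<noteq> \<infinity>" "\<bar>h y\<bar> \<noteq> \<infinity>"
  shows "0 \<le> (u - w) \<bullet> (x - y)"
proof -
  obtain r s where rs: "h x = ereal r" "h y = ereal s" using assms by (cases "h x"; cases "h y") auto
  have "r + u \<bullet> (y - x) \<le> s" "s + w \<bullet> (x - y) \<le> r"
    using assms(1,2) rs by (auto simp: subdifferential_def dest: spec[of _ x] spec[of _ y])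
  then show ?thesis by (simp add: algebra_simps)
qed

text \<open>Monotonicity of the subdifferential, applied to the subgradients from
  \<open>prox_subgradient\<close>, gives firm nonexpansiveness
  \<open>norm d * norm d \<le> (u - v) \<bullet> d\<close>; Cauchy-Schwarz does the rest.\<close>

lemma prox_nonexpansive:
  fixes h :: "'a::euclidean_space \<Rightarrow> ereal"
  assumes h: "closed_fun h" "proper_fun h" "convex_fun h" "\<alpha> > 0"
  shows "norm (prox \<alpha> h u - prox \<alpha> h v) \<le> norm (u - v)"
proof -
  define d where "d = prox \<alpha> h u - prox \<alpha> h v"
  have "0 \<le> ((1 / \<alpha>) *\<^sub>R (u - prox \<alpha> h u) - (1 / \<alpha>) *\<^sub>R (v - prox \<alpha> h v)) \<bullet> d"
    unfolding d_def
    using prox_finite[OF h, of u] prox_finite[OF h, of v]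
    by (intro subdifferential_monotone[of _ h] prox_subgradient h) force+
  also have "\<dots> = (1 / \<alpha>) * ((u - v) \<bullet> d - d \<bullet> d)"
    by (simp add: d_def algebra_simps)
  finally have "norm d * norm d \<le> (u - v) \<bullet> d"
    using h by (simp add: zero_le_divide_iff flip: power2_norm_eq_inner power2_eq_square)
  also have "\<dots> \<le> norm (u - v) * norm d" by (rule norm_cauchy_schwarz)
  finally show ?thesis unfolding d_def[symmetric]
    by (cases "norm d = 0") (auto dest: mult_right_le_imp_le)
qed

section \<open>Mixing by doubly stochastic matrices\<close>

lemma doubly_stochastic_mat_1: "doubly_stochastic (mat 1)"
  by (auto simp: doubly_stochastic_def mat_def)

lemma doubly_stochastic_mult:
  fixes M N :: "real ^ 'm ^ 'm"
  assumes M: "doubly_stochastic M" and N: "doubly_stochastic N"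
  shows "doubly_stochastic (M ** N)"
proof -
  have "(\<Sum>j\<in>UNIV. \<Sum>k\<in>UNIV. M $ i $ k * N $ k $ j) = 1" for i
    using M N by (subst sum.swap) (simp add: doubly_stochastic_def flip: sum_distrib_left)
  moreover have "(\<Sum>i\<in>UNIV. \<Sum>k\<in>UNIV. M $ i $ k * N $ k $ j) = 1" for j
    using M N by (subst sum.swap) (simp add: doubly_stochastic_def flip: sum_distrib_right)
  ultimately show ?thesis
    using M N by (auto simp: doubly_stochastic_def matrix_matrix_mult_def intro!: sum_nonneg)
qed

text \<open>The matrix acts on families of vectors, one per agent, so consensus needs no coordinates
  of \<open>'a\<close>.\<close>

definition mix :: "real ^ 'm ^ 'm \<Rightarrow> ('m::finite \<Rightarrow> 'a::real_vector) \<Rightarrow> 'm \<Rightarrow> 'a" where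
  "mix M d i = (\<Sum>j\<in>UNIV. M $ i $ j *\<^sub>R d j)"

lemma mix_mult: "mix (M ** N) d = mix M (mix N d)"
proof
  fix i
  have "mix (M ** N) d i = (\<Sum>j\<in>UNIV. \<Sum>k\<in>UNIV. (M $ i $ k * N $ k $ j) *\<^sub>R d j)"
    by (simp add: mix_def matrix_matrix_mult_def scaleR_sum_left)
  also have "\<dots> = mix M (mix N d) i"
    by (subst sum.swap) (simp add: mix_def scaleR_sum_right)
  finally show "mix (M ** N) d i = mix M (mix N d) i" .
qed

lemma sum_mix:
  assumes "doubly_stochastic M"
  shows "(\<Sum>i\<in>UNIV. mix M d i) = (\<Sum>j\<in>UNIV. d j)"
  unfolding mix_def using assms
  by (subst sum.swap) (simp add: doubly_stochastic_def flip: scaleR_sum_left)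

lemma mix_minus_const:
  assumes "doubly_stochastic M"
  shows "mix M (\<lambda>j. d j - c) i = mix M d i - c"
  using assms
  by (simp add: mix_def doubly_stochastic_def scaleR_diff_right sum_subtractf flip: scaleR_sum_left)

lemma norm_mix_le:
  fixes d :: "'m::finite \<Rightarrow> 'a::real_normed_vector"
  assumes M: "doubly_stochastic M" and d: "\<And>j. norm (d j) \<le> c"
  shows "norm (mix M d i) \<le> c"
proof -
  have "norm (mix M d i) \<le> (\<Sum>j\<in>UNIV. M $ i $ j * c)"
    unfolding mix_def using M d
    by (intro sum_norm_le) (auto simp: doubly_stochastic_def intro!: mult_left_mono)
  also have "\<dots> = c" using M by (simp add: doubly_stochastic_def flip: sum_distrib_right)
  finally show ?thesis .
qed

text \<open>On families with zero sum, \<open>M\<close> acts like \<open>M - \<delta>\<close> (entrywise), whose entries are still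
  nonnegative but whose row sums are at most \<open>1 - \<delta>\<close>.\<close>

lemma norm_mix_contraction:
  fixes d :: "'m::finite \<Rightarrow> 'a::real_normed_vector"
  assumes M: "doubly_stochastic M" and \<delta>: "0 \<le> \<delta>" "\<And>i j. \<delta> \<le> M $ i $ j"
    and d: "(\<Sum>j\<in>UNIV. d j) = 0" "\<And>j. norm (d j) \<le> c"
  shows "norm (mix M d i) \<le> (1 - \<delta>) * c"
proof -
  have c: "c \<ge> 0" using d(2)[of undefined] norm_ge_zero order_trans by blast
  have "mix M d i = (\<Sum>j\<in>UNIV. (M $ i $ j - \<delta>) *\<^sub>R d j)"
    using d(1) by (simp add: mix_def scaleR_diff_left sum_subtractf flip: scaleR_sum_right)
  also have "norm \<dots> \<le> (\<Sum>j\<in>UNIV. (M $ i $ j - \<delta>) * c)"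
    using \<delta> d by (intro sum_norm_le) (auto intro!: mult_left_mono)
  also have "\<dots> = (1 - real CARD('m) * \<delta>) * c"
    using M by (simp add: doubly_stochastic_def sum_subtractf flip: sum_distrib_right)
  also have "\<dots> \<le> (1 - \<delta>) * c"
  proof -
    have "1 \<le> real CARD('m)" by (simp add: Suc_leI)
    then have "1 * \<delta> \<le> real CARD('m) * \<delta>" using \<delta> by (intro mult_right_mono)
    then show ?thesis using c by (intro mult_right_mono) auto
  qed
  finally show ?thesis .
qed

section \<open>Products of weight matrices over time windows\<close>

lemma Phi_less: "t < s \<Longrightarrow> Phi A t s = mat 1"
  by (cases t) auto

lemma Phi_mult:
  assumes "1 \<le> s" "s \<le> Suc r" "r \<le> t"
  shows "Phi A t s = Phi A t (Suc r) ** Phi A r s"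
  using assms(3)
proof (induction t rule: dec_induct)
  case base
  then show ?case by (simp add: Phi_less)
next
  case (step t)
  then show ?case using assms by (simp add: matrix_mul_assoc)
qed

lemma doubly_stochastic_Phi:
  assumes "\<And>t. 1 \<le> t \<Longrightarrow> doubly_stochastic (A t)" "1 \<le> s"
  shows "doubly_stochastic (Phi A t s)"
  using assms by (induction t) (auto simp: doubly_stochastic_mat_1 intro!: doubly_stochastic_mult)

text \<open>All entries are nonnegative, so one path of weight at least \<open>\<eta> ^ B\<close>
  suffices: wait at \<open>j\<close>, cross the direct link to \<open>i\<close> once, then wait at
  \<open>i\<close>.\<close>

lemma Phi_block_lower_bound:
  fixes A :: "nat \<Rightarrow> real ^ 'm::finite ^ 'm"
  assumes ds: "\<And>t. 1 \<le> t \<Longrightarrow> doubly_stochastic (A t)"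
    and \<eta>: "0 \<le> \<eta>" and diag: "\<And>t i. 1 \<le> t \<Longrightarrow> \<eta> \<le> A t $ i $ i"
    and conn: "\<And>i j t. i \<noteq> j \<Longrightarrow> 1 \<le> t \<Longrightarrow> \<exists>s\<in>{t..t + B - 1}. \<eta> \<le> A s $ i $ j"
    and s: "1 \<le> s"
  shows "\<eta> ^ B \<le> Phi A (s + B - 1) s $ i $ j"
proof -
  \<comment> \<open>\<open>Phi A (s + n - 1) s\<close> has \<open>n\<close> factors; for
    \<open>n = 0\<close> it is the identity, since \<open>1 \<le> s\<close>. Only the term through
    agent \<open>k\<close> of the matrix product is kept.\<close>
  have step: "A (s + n) $ i $ k * Phi A (s + n - 1) s $ k $ j \<le> Phi A (s + Suc n - 1) s $ i $ j" for i j k n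
  proof -
    obtain m where m: "s + n = Suc m" using s by (cases "s + n") auto
    have "Phi A (s + Suc n - 1) s = A (s + n) ** Phi A (s + n - 1) s"
      using m by (simp add: not_le)
    moreover have "A (s + n) $ i $ k * Phi A (s + n - 1) s $ k $ j
        \<le> (\<Sum>k\<in>UNIV. A (s + n) $ i $ k * Phi A (s + n - 1) s $ k $ j)"
      using ds[of "s + n"] doubly_stochastic_Phi[of A s "s + n - 1"] ds s
      by (intro member_le_sum) (auto simp: doubly_stochastic_def)
    ultimately show ?thesis by (simp add: matrix_matrix_mult_def)
  qed
  have pow: "\<eta> ^ Suc n \<le> Phi A (s + Suc n - 1) s $ i $ j"
    if "\<eta> \<le> A (s + n) $ i $ k" "\<eta> ^ n \<le> Phi A (s + n - 1) s $ k $ j" for i j k n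
  proof -
    have "\<eta> * \<eta> ^ n \<le> A (s + n) $ i $ k * Phi A (s + n - 1) s $ k $ j"
      using that \<eta> by (intro mult_mono) (auto intro: order_trans[of 0 \<eta>])
    then show ?thesis using step[of n i k j] by simp
  qed
  have diag_n: "\<eta> ^ n \<le> Phi A (s + n - 1) s $ i $ i" for i n
  proof (induction n)
    case 0
    then show ?case using s by (simp add: Phi_less mat_def)
  next
    case (Suc n)
    then show ?case using pow[of n i i i] diag[of "s + n" i] s by simp
  qed
  show ?thesis
  proof (cases "i = j")
    case False
    obtain u where u: "s \<le> u" "u \<le> s + B - 1" "\<eta> \<le> A u $ i $ j"
      using conn[OF False s] by auto
    \<comment> \<open>For \<open>B = 0\<close> the window containing \<open>u\<close> would be
      empty.\<close>
    have B: "Suc (u - s) \<le> B"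
    proof (cases B)
      case 0 then show ?thesis using u s by simp
    qed (use u in auto)
    have "\<eta> ^ n \<le> Phi A (s + n - 1) s $ i $ j" if "Suc (u - s) \<le> n" for n
      using that
    proof (induction n rule: dec_induct)
      case base
      show ?case using pow[of "u - s" i j j] diag_n[of "u - s" j] u by simp
    next
      case (step n)
      then show ?case using pow[of n i i j] diag[of "s + n" i] s by simp
    qed
    with B show ?thesis by blast
  qed (use diag_n in blast)
qed

text \<open>Peel off the latest \<open>B\<close> factors, which contract by
  \<open>1 - \<delta>\<close>, and recurse on the earlier ones; mixing preserves the zero sum that
  the contraction needs. Fewer than \<open>B\<close> factors are merely nonexpansive, hence
  \<open>n div B\<close>.\<close>

lemma norm_mix_Phi_le:
  fixes A :: "nat \<Rightarrow> real ^ 'm::finite ^ 'm" and d :: "'m \<Rightarrow> 'a::real_normed_vector"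
  assumes ds: "\<And>t. 1 \<le> t \<Longrightarrow> doubly_stochastic (A t)"
    and \<delta>: "0 \<le> \<delta>" and B: "1 \<le> B"
    and block: "\<And>s i j. 1 \<le> s \<Longrightarrow> \<delta> \<le> Phi A (s + B - 1) s $ i $ j"
    and s: "1 \<le> s" and d: "(\<Sum>j\<in>UNIV. d j) = 0" "\<And>j. norm (d j) \<le> c"
  shows "norm (mix (Phi A (s + n - 1) s) d i) \<le> (1 - \<delta>) ^ (n div B) * c"
proof (induction n arbitrary: i rule: less_induct)
  case (less n)
  show ?case
  proof (cases "n < B")
    case True
    
    have "doubly_stochastic (Phi A (s + n - 1) s)" by (intro doubly_stochastic_Phi ds s)
    then show ?thesis using True norm_mix_le[OF _ d(2)] by simp
  next
    case False
    let ?s = "s + (n - B)"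
    have s': "s + n - 1 = ?s + B - 1" "Suc (?s - 1) = ?s" using False s B by linarith+
    have "Phi A (s + n - 1) s = Phi A (?s + B - 1) ?s ** Phi A (?s - 1) s"
      unfolding s'(1) by (subst Phi_mult[of s "?s - 1"]) (use s s' in \<open>simp_all only: s'\<close>, use s B in linarith)
    then have eq: "mix (Phi A (s + n - 1) s) d = mix (Phi A (?s + B - 1) ?s) (mix (Phi A (?s - 1) s) d)"
      by (simp add: mix_mult)
    have "norm (mix (Phi A (s + n - 1) s) d i) \<le> (1 - \<delta>) * ((1 - \<delta>) ^ ((n - B) div B) * c)"
      unfolding eq
    proof (rule norm_mix_contraction)
      have "1 \<le> ?s" using s by simp
      then show "doubly_stochastic (Phi A (?s + B - 1) ?s)" "\<delta> \<le> Phi A (?s + B - 1) ?s $ i $ j" for i j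
        by (blast intro: doubly_stochastic_Phi ds block)+
      have "doubly_stochastic (Phi A (?s - 1) s)" by (intro doubly_stochastic_Phi ds s)
      then show "(\<Sum>j\<in>UNIV. mix (Phi A (?s - 1) s) d j) = 0" by (simp add: sum_mix d(1))
      show "norm (mix (Phi A (?s - 1) s) d j) \<le> (1 - \<delta>) ^ ((n - B) div B) * c" for j
        using less.IH[of "n - B" j] False B by simp
    qed (rule \<delta>)
    moreover have "n div B = Suc ((n - B) div B)" using False B by (simp add: div_if)
    ultimately show ?thesis by simp
  qed
qed

text \<open>With \<open>r\<close> the \<open>B\<close>-th root of \<open>\<rho>\<close>, rounding in
  \<open>k div B\<close> costs at most a factor \<open>1 / \<rho>\<close>, so the terms are
  dominated by the differentiated geometric series in \<open>r\<close>.\<close>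

lemma summable_pow_div_linear:
  fixes \<rho> :: real
  assumes \<rho>: "0 < \<rho>" "\<rho> < 1" and B: "1 \<le> B"
  shows "summable (\<lambda>k. \<rho> ^ (k div B) * (a + b * real k))"
proof -
  define r where "r = root B \<rho>"
  have r: "0 < r" "r < 1" "r ^ B = \<rho>" using assms by (auto simp: r_def)
  have pow: "\<rho> ^ (k div B) \<le> r ^ k / \<rho>" for k
  proof -
    have "r ^ B * r ^ (B * (k div B)) \<le> r ^ (k mod B) * r ^ (B * (k div B))"
      using r B by (intro mult_right_mono power_decreasing) (auto simp: less_imp_le)
    also have "\<dots> = r ^ k" by (simp flip: power_add)
    finally show ?thesis using r \<rho> by (simp add: power_mult field_simps)
  qed
  have bound: "norm (\<rho> ^ (k div B) * (a + b * real k)) \<le> (\<bar>a\<bar> + \<bar>b\<bar>) / \<rho> * (real (Suc k) * r ^ k)" for k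
  proof -
    have "\<bar>a + b * real k\<bar> \<le> \<bar>a\<bar> + \<bar>b\<bar> * real k"
      using abs_triangle_ineq[of a "b * real k"] by (simp add: abs_mult)
    also have "\<dots> \<le> (\<bar>a\<bar> + \<bar>b\<bar>) * real (Suc k)"
      by (simp add: algebra_simps)
    finally have "\<bar>a + b * real k\<bar> \<le> (\<bar>a\<bar> + \<bar>b\<bar>) * real (Suc k)" .
    then have "\<bar>\<rho> ^ (k div B)\<bar> * \<bar>a + b * real k\<bar> \<le> r ^ k / \<rho> * ((\<bar>a\<bar> + \<bar>b\<bar>) * real (Suc k))"
      using pow[of k] \<rho> r by (intro mult_mono) auto
    then show ?thesis by (simp add: abs_mult mult_ac)
  qed
  have "summable (\<lambda>k. (\<bar>a\<bar> + \<bar>b\<bar>) / \<rho> * (real (Suc k) * r ^ k))"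
    using r sums_summable[OF geometric_deriv_sums[of r]] by (intro summable_mult) auto
  then show ?thesis by (rule summable_comparison_test'[where N = 0]) (rule bound)
qed

section \<open>Descent\<close>

lemma summable_if_descent:
  fixes a F s :: "nat \<Rightarrow> real"
  assumes a: "\<And>k. 0 \<le> a k" "\<And>k. a k \<le> F k - F (Suc k) + s k"
    and F: "\<And>k. l \<le> F k" and s: "summable s" "\<And>k. 0 \<le> s k"
  shows "summable a"
proof (rule summableI_nonneg_bounded)
  show "0 \<le> a k" for k by (rule a)
  fix n
  have "(\<Sum>k<n. a k) \<le> (\<Sum>k<n. F k - F (Suc k) + s k)" by (intro sum_mono a)
  also have "\<dots> = F 0 - F n + (\<Sum>k<n. s k)" by (simp add: sum.distrib sum_lessThan_telescope')
  also have "\<dots> \<le> F 0 - l + suminf s" using F[of n] sum_le_suminf[OF s(1), of "{..<n}"] s(2) by simp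
  finally show "(\<Sum>k<n. a k) \<le> F 0 - l + suminf s" .
qed

text \<open>Along the segment from \<open>x\<close> to \<open>y\<close>, the excess
  \<open>\<psi>\<close> of \<open>g\<close> over its quadratic model has nonpositive derivative, by
  Cauchy-Schwarz and the Lipschitz bound on \<open>G\<close>.\<close>

lemma GDERIV_descent:
  assumes g: "\<And>y. GDERIV g y :> G y"
    and L: "\<And>y z. norm (G y - G z) \<le> L * norm (y - z)"
  shows "g y \<le> g x + G x \<bullet> (y - x) + L / 2 * (norm (y - x))\<^sup>2"
proof -
  define d where "d = y - x"
  define \<psi> where "\<psi> t = g (x + t *\<^sub>R d) - t * (G x \<bullet> d) - L / 2 * t\<^sup>2 * (norm d)\<^sup>2" for t
  have line: "((\<lambda>t. g (x + t *\<^sub>R d)) has_real_derivative G (x + t *\<^sub>R d) \<bullet> d) (at t)" for t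
  proof -
    have "((\<lambda>t. x + t *\<^sub>R d) has_derivative (\<lambda>t. t *\<^sub>R d)) (at t)"
      by (auto intro!: derivative_eq_intros)
    from has_derivative_compose[OF this g[of "x + t *\<^sub>R d", unfolded gderiv_def]]
    show ?thesis by (simp add: has_field_derivative_def mult_commute_abs inner_commute)
  qed
  have "\<psi> 1 \<le> \<psi> 0"
  proof (rule DERIV_nonpos_imp_nonincreasing[where f = \<psi>])
    fix t :: real assume t: "0 \<le> t" "t \<le> 1"
    have "(\<psi> has_real_derivative G (x + t *\<^sub>R d) \<bullet> d - G x \<bullet> d - L * t * (norm d)\<^sup>2) (at t)"
      unfolding \<psi>_def by (rule derivative_eq_intros line refl | simp)+
    moreover have "(G (x + t *\<^sub>R d) - G x) \<bullet> d \<le> L * t * (norm d)\<^sup>2"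
    proof -
      have "(G (x + t *\<^sub>R d) - G x) \<bullet> d \<le> norm (G (x + t *\<^sub>R d) - G x) * norm d"
        by (rule norm_cauchy_schwarz)
      also have "\<dots> \<le> L * norm (x + t *\<^sub>R d - x) * norm d" by (intro mult_right_mono L) auto
      finally show ?thesis using t by (simp add: power2_eq_square mult.assoc)
    qed
    ultimately show "\<exists>D. (\<psi> has_real_derivative D) (at t) \<and> D \<le> 0"
      by (auto simp: inner_diff_left)
  qed simp
  then show ?thesis by (simp add: \<psi>_def d_def)
qed

lemma GDERIV_Lipschitz:
  assumes "\<And>y. GDERIV g y :> G y" and "\<And>y. norm (G y) \<le> K"
  shows "\<bar>g y - g x\<bar> \<le> K * norm (y - x)"
proof -
  have "norm (g y - g x) \<le> K * norm (y - x)"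
  proof (rule differentiable_bound[of UNIV])
    show "(g has_derivative (\<bullet>) (G y)) (at y within UNIV)" for y
      using assms(1)[of y] unfolding gderiv_def by (simp add: inner_commute[of _ "G y"])
    have "\<bar>G y \<bullet> d\<bar> \<le> K * norm d" for y d
      using Cauchy_Schwarz_ineq2[of "G y" d] mult_right_mono[OF assms(2), of "norm d" y] by simp
    moreover have "0 \<le> K" using assms(2)[of undefined] norm_ge_zero order_trans by blast
    ultimately show "onorm ((\<bullet>) (G y)) \<le> K" for y
      by (intro onorm_bound) auto
  qed auto
  then show ?thesis by simp
qed

section \<open>Averages over the agents\<close>

definition avg :: "('m::finite \<Rightarrow> 'a::real_vector) \<Rightarrow> 'a" where
  "avg f = (1 / real CARD('m)) *\<^sub>R (\<Sum>i\<in>UNIV. f i)"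

lemma xbar_eq_avg: "1 \<le> k \<Longrightarrow> xbar x k = avg (\<lambda>i. x i k)"
  by (simp add: xbar_def avg_def)

lemma sum_eq_avg: "(\<Sum>i\<in>UNIV. f i) = real CARD('m) *\<^sub>R avg (f :: 'm::finite \<Rightarrow> 'a::real_vector)"
  by (simp add: avg_def)

lemma avg_diff: "avg f - avg g = avg (\<lambda>i. f i - g i)"
  by (simp add: avg_def sum_subtractf scaleR_diff_right)

lemma avg_const [simp]: "avg (\<lambda>i :: 'm::finite. c) = c"
  by (simp add: avg_def sum_constant_scaleR)

lemma avg_scaleR: "avg (\<lambda>i. c *\<^sub>R f i) = c *\<^sub>R avg f"
  by (simp add: avg_def scaleR_sum_right)

lemma norm_avg_le:
  fixes f :: "'m::finite \<Rightarrow> 'a::real_normed_vector"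
  assumes "\<And>i. norm (f i) \<le> c"
  shows "norm (avg f) \<le> c"
proof -
  have "norm (\<Sum>i\<in>UNIV. f i) \<le> real CARD('m) * c"
    using sum_norm_bound[of UNIV f c] assms by simp
  then show ?thesis by (simp add: avg_def pos_divide_le_eq mult.commute)
qed

lemma GDERIV_avg:
  fixes g :: "'m::finite \<Rightarrow> 'a::real_inner \<Rightarrow> real"
  assumes "\<And>i. GDERIV (g i) y :> G i"
  shows "GDERIV (\<lambda>y. avg (\<lambda>i. g i y)) y :> avg G"
proof -
  have "((\<lambda>y. avg (\<lambda>i. g i y)) has_derivative (\<lambda>d. avg (\<lambda>i. d \<bullet> G i))) (at y)"
    unfolding avg_def using assms
    by (intro has_derivative_scaleR_right has_derivative_sum) (simp add: gderiv_def)
  moreover have "(\<lambda>d. avg (\<lambda>i. d \<bullet> G i)) = (\<lambda>d. d \<bullet> avg G)"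
    by (simp add: avg_def inner_sum_right)
  ultimately show ?thesis by (simp add: gderiv_def)
qed

text \<open>Here \<open>d\<close> is an approximate gradient at \<open>y\<close>. The prox
  subgradient at \<open>w\<close>, tested at \<open>y\<close>, controls \<open>hr\<close> and yields
  \<open>1 / \<alpha>\<close>; the descent lemma controls \<open>g\<close> and costs
  \<open>L / 2\<close>. The error \<open>d - G y\<close> remains paired with the step.\<close>

lemma inexact_proximal_gradient_descent:
  fixes h :: "'a::euclidean_space \<Rightarrow> ereal"
  assumes h: "closed_fun h" "proper_fun h" "convex_fun h" and \<alpha>: "\<alpha> > 0"
    and hr: "\<And>y. h y = ereal (hr y)"
    and g: "\<And>y. GDERIV g y :> G y"
    and L: "\<And>y z. norm (G y - G z) \<le> L * norm (y - z)"
    and w: "w = prox \<alpha> h (y - \<alpha> *\<^sub>R d)"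
  shows "(1 / \<alpha> - L / 2) * (norm (w - y))\<^sup>2 \<le> (g y + hr y) - (g w + hr w) + (d - G y) \<bullet> (y - w)"
proof -
  have "hr w + (1 / \<alpha>) *\<^sub>R (y - \<alpha> *\<^sub>R d - w) \<bullet> (y - w) \<le> hr y"
    using prox_subgradient[OF h \<alpha>, of "y - \<alpha> *\<^sub>R d", folded w]
    by (simp only: subdifferential_def mem_Collect_eq hr plus_ereal.simps ereal_less_eq)
  moreover have "(1 / \<alpha>) *\<^sub>R (y - \<alpha> *\<^sub>R d - w) = (1 / \<alpha>) *\<^sub>R (y - w) - d"
    using \<alpha> by (simp add: algebra_simps)
  ultimately have "hr w + (1 / \<alpha>) * (norm (w - y))\<^sup>2 - d \<bullet> (y - w) \<le> hr y"
    by (simp add: inner_diff_left[of _ d] power2_norm_eq_inner[symmetric] norm_minus_commute)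
  moreover have "g w \<le> g y + G y \<bullet> (w - y) + L / 2 * (norm (w - y))\<^sup>2"
    by (rule GDERIV_descent[OF g L])
  ultimately show ?thesis by (simp add: algebra_simps)
qed

theorem mainTheorem3:
  fixes g :: "'m::finite \<Rightarrow> real ^ 'n \<Rightarrow> real"
    and grad :: "'m \<Rightarrow> real ^ 'n \<Rightarrow> real ^ 'n"
    and h :: "real ^ 'n \<Rightarrow> ereal"
    and A :: "nat \<Rightarrow> real ^ 'm ^ 'm"
    and E :: "nat \<Rightarrow> 'm set set"
    and x q v :: "'m \<Rightarrow> nat \<Rightarrow> real ^ 'n"
    and L G_g G_h \<eta> \<alpha> :: real
    and B :: nat
  assumes grad: "\<And>i y. GDERIV (g i) y :> grad i y"
    and grad_cont: "\<And>i. continuous_on UNIV (grad i)"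
    and L_pos: "0 < L"
    and grad_Lipschitz: "\<And>i y z. norm (grad i y - grad i z) \<le> L * norm (y - z)"
    and h_closed: "closed_fun h"
    and h_proper: "proper_fun h"
    and h_convex: "convex_fun h"
    and grad_bound: "\<And>i y. norm (grad i y) < G_g"
    and subgrad_bound: "\<And>y z. z \<in> subdifferential h y \<Longrightarrow> norm z < G_h"
    and optimum: "\<exists>xstar. is_arg_min (objective g h) (\<lambda>_. True) xstar"
    and undirected: "\<And>t e. 1 \<le> t \<Longrightarrow> e \<in> E t \<Longrightarrow> \<exists>i j. e = {i, j}"
    and A_symmetric: "\<And>t. 1 \<le> t \<Longrightarrow> transpose (A t) = A t"
    and A_doubly_stochastic: "\<And>t. 1 \<le> t \<Longrightarrow> doubly_stochastic (A t)"
    and eta: "0 < \<eta>" "\<eta> < 1"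
    and A_diag: "\<And>t i. 1 \<le> t \<Longrightarrow> \<eta> \<le> A t $ i $ i"
    and A_edge: "\<And>t i j. 1 \<le> t \<Longrightarrow> i \<noteq> j \<Longrightarrow> {i, j} \<in> E t \<Longrightarrow> \<eta> \<le> A t $ i $ j"
    and A_nonedge: "\<And>t i j. 1 \<le> t \<Longrightarrow> i \<noteq> j \<Longrightarrow> {i, j} \<notin> E t \<Longrightarrow> A t $ i $ j = 0"
    and inf_often: "\<And>i j. i \<noteq> j \<Longrightarrow> infinite {t. 1 \<le> t \<and> {i, j} \<in> E t}"
    and B_pos: "1 \<le> B"
    and B_connected: "\<And>i j t. i \<noteq> j \<Longrightarrow> 1 \<le> t \<Longrightarrow> \<exists>s\<in>{t..t + B - 1}. {i, j} \<in> E s"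
    and step_size: "0 < \<alpha>" "\<alpha> < 1 / L"
    and q_step: "\<And>i k. 1 \<le> k \<Longrightarrow> q i (k + 1) = x i k - \<alpha> *\<^sub>R grad i (x i k)"
    and v_step: "\<And>i k. 1 \<le> k \<Longrightarrow>
           v i (k + 1) = (\<Sum>j\<in>UNIV. mix_weight A i j (k + 1) *\<^sub>R q j (k + 1))"
    and x_step: "\<And>i k. 1 \<le> k \<Longrightarrow> x i (k + 1) = prox \<alpha> h (v i (k + 1))"
  shows "(\<lambda>T. 1 / real T * (\<Sum>k = 1..T. (norm (xbar x k - xbar x (k - 1)))\<^sup>2))
           \<in> O(\<lambda>T. 1 / real T)"
proof -

  \<comment> \<open>Consequences of the gradient and subgradient bounds\<close>
  note h = h_closed h_proper h_convex
  define G where "G = G_g + G_h"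
  have grad_le: "norm (grad i y) \<le> G_g" for i y using grad_bound less_imp_le by blast
  have sb: "norm z \<le> G_h" if "z \<in> subdifferential h y" for y z
    using subgrad_bound[OF that] by simp
  have Gg: "0 \<le> G_g" using grad_le[of undefined undefined] norm_ge_zero order_trans by blast
  \<comment> \<open>\<open>prox_subgradient\<close> supplies an actual subgradient, which forces the
    bound to be nonnegative.\<close>
  have Gh: "0 \<le> G_h" using sb[OF prox_subgradient[OF h step_size(1)]] norm_ge_zero order_trans by blast
  have G: "0 \<le> G" using Gg Gh by (simp add: G_def)

  have h_le: "h u \<le> h y + ereal (G_h * norm (u - y))" for u y
    by (rule Lipschitz_if_bounded_subgradients[OF h sb])
  obtain y0 where y0: "h y0 \<noteq> \<infinity>" using h_proper by (auto simp: proper_fun_def)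
  \<comment> \<open>The Lipschitz bound from a single point \<open>y0\<close> of the domain makes
    \<open>h\<close> finite everywhere.\<close>
  have "h y \<noteq> \<infinity>" "h y \<noteq> -\<infinity>" for y
    using h_le[of y y0] y0 h_proper by (auto simp: proper_fun_def)
  define hr where "hr y = real_of_ereal (h y)" for y
  have hr: "h y = ereal (hr y)" for y
    unfolding hr_def using \<open>h y \<noteq> \<infinity>\<close> \<open>h y \<noteq> -\<infinity>\<close> by (cases "h y") auto
  have hr_le: "hr u \<le> hr y + G_h * norm (u - y)" for u y
    using h_le[of u y] by (simp add: hr)
  have prox_dist: "norm (prox \<alpha> h u - u) \<le> \<alpha> * G_h" for u
    using sb[OF prox_subgradient[OF h step_size(1), of u]] step_size(1) unfolding norm_scaleR
    by (simp add: pos_divide_le_eq norm_minus_commute mult.commute)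

  \<comment> \<open>Mixing matrices of the iterations\<close>
  define \<delta> where "\<delta> = \<eta> ^ B"
  have \<delta>: "0 < \<delta>" "\<delta> < 1" using eta B_pos by (auto simp: \<delta>_def power_less_one_iff)
  have block: "\<delta> \<le> Phi A (s + B - 1) s $ i $ j" if "1 \<le> s" for s i j
    unfolding \<delta>_def
  proof (rule Phi_block_lower_bound[OF A_doubly_stochastic _ A_diag _ that])
    show "\<exists>s\<in>{t..t + B - 1}. \<eta> \<le> A s $ i $ j" if ij: "i \<noteq> j" "1 \<le> t" for i j t
    proof -
      obtain u where "u \<in> {t..t + B - 1}" "{i, j} \<in> E u" using B_connected[OF ij] by blast
      with A_edge[of u i j] ij show ?thesis by (intro bexI[of _ u]) auto
    qed
  qed (use eta in auto)

  \<comment> \<open>Producing \<open>x i (k + 1)\<close> uses the weights at times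
    \<open>s k\<close> to \<open>s k + k + 1\<close>, that is \<open>k + 2\<close> factors; the form
    of \<open>P\<close> matches \<open>norm_mix_Phi_le\<close>.\<close>
  define s where "s k = comm_steps (k + 1)" for k
  define P where "P k = Phi A (s k + (k + 2) - 1) (s k)" for k
  have s: "1 \<le> s k" if "1 \<le> k" for k
    using that member_le_sum[of 1 "{1..k}" "\<lambda>l. l"] by (simp add: s_def comm_steps_def)
  have dsP: "doubly_stochastic (P k)" if "1 \<le> k" for k
    unfolding P_def by (intro doubly_stochastic_Phi A_doubly_stochastic s that)
  have v: "v i (k + 1) = mix (P k) (\<lambda>j. q j (k + 1)) i" if "1 \<le> k" for i k
  proof -
    have "s k + (k + 2) - 1 = comm_steps (k + 1) + (k + 1)" by (simp add: s_def)
    then show ?thesis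
      by (simp only: v_step[OF that] mix_def mix_weight_def P_def s_def)
  qed

  \<comment> \<open>Linear growth of the iterates\<close>
  define M where "M = (\<Sum>i\<in>UNIV. norm (x i 1))"
  have q_le: "norm (q i (k + 1)) \<le> norm (x i k) + \<alpha> * G_g" if "1 \<le> k" for i k
  proof -
    have "norm (\<alpha> *\<^sub>R grad i (x i k)) \<le> \<alpha> * G_g"
      using grad_le step_size by simp
    then show ?thesis
      unfolding q_step[OF that]
      using norm_triangle_ineq4[of "x i k" "\<alpha> *\<^sub>R grad i (x i k)"] by linarith
  qed
  \<comment> \<open>One iteration adds at most \<open>\<alpha> * G_g\<close> by the gradient step,
    nothing by mixing, and \<open>\<alpha> * G_h\<close> by the prox step.\<close>
  have x_le: "norm (x i k) \<le> M + \<alpha> * G * real k" if "1 \<le> k" for i k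
    using that
  proof (induction k arbitrary: i rule: dec_induct)
    case base
    have "norm (x i 1) \<le> M" unfolding M_def by (rule member_le_sum) auto
    then show ?case using G step_size by (simp add: add_increasing2)
  next
    case (step k)
    have "norm (q j (k + 1)) \<le> M + \<alpha> * G * real k + \<alpha> * G_g" for j
      using q_le[OF step(1), of j] step.IH[of j] by simp
    then have "norm (v i (k + 1)) \<le> M + \<alpha> * G * real k + \<alpha> * G_g"
      unfolding v[OF step(1)] by (intro norm_mix_le dsP step)
    moreover have "norm (x i (k + 1)) \<le> norm (v i (k + 1)) + norm (x i (k + 1) - v i (k + 1))"
      by (rule norm_triangle_sub)
    moreover have "norm (x i (k + 1) - v i (k + 1)) \<le> \<alpha> * G_h"
      unfolding x_step[OF step(1)] by (rule prox_dist)
    ultimately show ?case by (simp add: G_def algebra_simps)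
  qed

  \<comment> \<open>Summable disagreement\<close>
  define vb where "vb k = avg (\<lambda>j. q j (k + 1))" for k
  \<comment> \<open>The last factor is twice the bound
    \<open>M + \<alpha> * G * real k + \<alpha> * G\<close> on all \<open>q j (k + 1)\<close>, hence
    bounds their deviations from the mean \<open>vb k\<close>.\<close>
  define e where "e k = (1 - \<delta>) ^ (k div B) * (2 * (M + \<alpha> * G) + 2 * \<alpha> * G * real k)" for k
  have M: "0 \<le> M" by (simp add: M_def sum_nonneg)
  have e_nonneg: "0 \<le> e k" for k using \<delta> M G step_size by (simp add: e_def)
  have e: "summable e"
    unfolding e_def using \<delta> B_pos by (intro summable_pow_div_linear) auto
  have v_dev: "norm (v i (k + 1) - vb k) \<le> e k" if k: "1 \<le> k" for i k
  proof -
    define c where "c = M + \<alpha> * G * real k + \<alpha> * G"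
    have c: "norm (q j (k + 1)) \<le> c" for j
    proof -
      have "\<alpha> * G_g \<le> \<alpha> * G" using step_size Gh by (simp add: G_def)
      then show ?thesis using q_le[OF k, of j] x_le[OF k, of j] by (simp add: c_def)
    qed
    have "norm (vb k) \<le> c" unfolding vb_def by (intro norm_avg_le c)
    then have "norm (q j (k + 1) - vb k) \<le> 2 * c" for j
      using norm_triangle_ineq4[of "q j (k + 1)" "vb k"] c[of j] by linarith
    moreover have "(\<Sum>j\<in>UNIV. q j (k + 1) - vb k) = 0"
      by (simp add: sum_subtractf sum_eq_avg vb_def del: sum_constant)
    ultimately have "norm (mix (P k) (\<lambda>j. q j (k + 1) - vb k) i) \<le> (1 - \<delta>) ^ ((k + 2) div B) * (2 * c)"
      unfolding P_def using \<delta> by (intro norm_mix_Phi_le A_doubly_stochastic B_pos block s k) auto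
    also have "\<dots> \<le> (1 - \<delta>) ^ (k div B) * (2 * c)"
      using \<delta> M G step_size
      by (intro mult_right_mono power_decreasing div_le_mono) (auto simp: c_def)
    also have "\<dots> = e k" by (simp add: e_def c_def algebra_simps)
    finally show ?thesis unfolding v[OF k] mix_minus_const[OF dsP[OF k]] .
  qed

  \<comment> \<open>Comparison with the centralised proximal gradient step\<close>
  define xb where "xb k = avg (\<lambda>i. x i k)" for k
  define d where "d k = avg (\<lambda>i. grad i (x i k))" for k
  \<comment> \<open>The point every agent would reach from exact consensus on \<open>vb k\<close>:
    an inexact proximal gradient step from \<open>xb k\<close>, as \<open>d k\<close> averages
    gradients taken at different points.\<close>
  define w where "w k = prox \<alpha> h (vb k)" for k
  have vb: "vb k = xb k - \<alpha> *\<^sub>R d k" if "1 \<le> k" for k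
    unfolding vb_def xb_def d_def q_step[OF that] by (simp flip: avg_diff avg_scaleR)
  have x_w: "norm (x i (k + 1) - w k) \<le> e k" if "1 \<le> k" for i k
    unfolding x_step[OF that] w_def
    using prox_nonexpansive[OF h step_size(1)] v_dev[OF that] by (rule order_trans)
  have xb_w: "norm (xb (k + 1) - w k) \<le> e k" if "1 \<le> k" for k
  proof -
    have "xb (k + 1) - w k = avg (\<lambda>i. x i (k + 1) - w k)"
      by (simp add: xb_def flip: avg_diff)
    then show ?thesis using norm_avg_le[OF x_w[OF that]] by simp
  qed

  \<comment> \<open>The averaged objective\<close>
  define gbar where "gbar y = avg (\<lambda>i. g i y)" for y
  define Gr where "Gr y = avg (\<lambda>i. grad i y)" for y
  define F where "F y = gbar y + hr y" for y
  have gbar_deriv: "GDERIV gbar y :> Gr y" for y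
    unfolding gbar_def Gr_def by (intro GDERIV_avg grad)
  have Gr_Lipschitz: "norm (Gr y - Gr z) \<le> L * norm (y - z)" for y z
    unfolding Gr_def avg_diff by (intro norm_avg_le grad_Lipschitz)
  have "norm (Gr y) \<le> G_g" for y
    unfolding Gr_def by (intro norm_avg_le grad_le)
  then have gbar_le: "\<bar>gbar y - gbar z\<bar> \<le> G_g * norm (y - z)" for y z
    by (rule GDERIV_Lipschitz[OF gbar_deriv])
  have F_le: "F y \<le> F z + G * norm (y - z)" for y z
    using hr_le[of y z] gbar_le[of y z] by (simp add: F_def G_def distrib_right abs_le_iff)
  obtain xstar where "is_arg_min (objective g h) (\<lambda>_. True) xstar" using optimum by blast
  \<comment> \<open>The copies of \<open>h\<close>, one per agent, have total weight 1.\<close>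
  moreover have "objective g h y = ereal (F y)" for y
    by (simp add: objective_def hr F_def gbar_def avg_def sum.distrib distrib_left)
  ultimately have F_min: "F xstar \<le> F y" for y by (auto simp: is_arg_min_def not_less)

  \<comment> \<open>Each agent and the mean are both within \<open>e k\<close> of
    \<open>w k\<close>, hence the factor 2.\<close>
  have d_Gr: "norm (d (k + 1) - Gr (xb (k + 1))) \<le> 2 * L * e k" if "1 \<le> k" for k
  proof -
    have "norm (x i (k + 1) - xb (k + 1)) \<le> 2 * e k" for i
      using norm_triangle_ineq4[of "x i (k + 1) - w k" "xb (k + 1) - w k"] x_w[OF that] xb_w[OF that]
      by (smt (verit) diff_diff_eq2 diff_add_cancel)
    then have "norm (grad i (x i (k + 1)) - grad i (xb (k + 1))) \<le> L * (2 * e k)" for i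
      using L_pos by (intro order_trans[OF grad_Lipschitz] mult_left_mono) auto
    from norm_avg_le[OF this] show ?thesis by (simp add: d_def Gr_def avg_diff mult_ac)
  qed
  have xb_w': "norm (xb k - w k) \<le> \<alpha> * G" if "1 \<le> k" for k
  proof -
    have "norm (d k) \<le> G_g" unfolding d_def by (intro norm_avg_le grad_le)
    then have "norm (xb k - vb k) \<le> \<alpha> * G_g" using step_size by (simp add: vb[OF that])
    moreover have "norm (vb k - w k) \<le> \<alpha> * G_h" using prox_dist[of "vb k"] by (simp add: w_def norm_minus_commute)
    ultimately show ?thesis
      using norm_triangle_ineq[of "xb k - vb k" "vb k - w k"] by (simp add: G_def distrib_left)
  qed

  \<comment> \<open>Summability of the squared steps\<close>
  define c where "c = 1 / \<alpha> - L / 2"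
  have "1 / \<alpha> > L" using step_size L_pos by (simp add: field_simps)
  then have c: "c > 0" using L_pos by (simp add: c_def)
  \<comment> \<open>Indices start at 2 because the initial points are arbitrary and \<open>e\<close>
    controls only iterates that have been mixed. The error has two sources: replacing
    \<open>w (k + 2)\<close> by the true mean costs \<open>G * e (k + 2)\<close>, and the inexact
    gradient, paired with a step of length at most \<open>\<alpha> * G\<close>, costs the
    rest.\<close>
  have "summable (\<lambda>k. c * (norm (w (k + 2) - xb (k + 2)))\<^sup>2)"
  proof (rule summable_if_descent)
    fix k
    show "0 \<le> c * (norm (w (k + 2) - xb (k + 2)))\<^sup>2" using c by simp
    show "F xstar \<le> F (xb (k + 2))" by (rule F_min)
    show "0 \<le> G * e (k + 2) + 2 * L * \<alpha> * G * e (k + 1)"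
      using G L_pos step_size e_nonneg by simp
    have "(d (k + 2) - Gr (xb (k + 2))) \<bullet> (xb (k + 2) - w (k + 2)) \<le> (2 * L * e (k + 1)) * (\<alpha> * G)"
      using d_Gr[of "k + 1"] xb_w'[of "k + 2"] L_pos e_nonneg
      by (intro order_trans[OF norm_cauchy_schwarz] mult_mono) (auto simp: numeral_2_eq_2)
    moreover have "c * (norm (w (k + 2) - xb (k + 2)))\<^sup>2
        \<le> F (xb (k + 2)) - F (w (k + 2)) + (d (k + 2) - Gr (xb (k + 2))) \<bullet> (xb (k + 2) - w (k + 2))"
      unfolding c_def F_def
      by (rule inexact_proximal_gradient_descent[OF h step_size(1) hr gbar_deriv Gr_Lipschitz])
         (simp add: w_def vb)
    moreover have "F (xb (Suc k + 2)) \<le> F (w (k + 2)) + G * e (k + 2)"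
      using F_le[of "xb (Suc k + 2)" "w (k + 2)"] mult_left_mono[OF xb_w[of "k + 2"] G] by simp
    ultimately show "c * (norm (w (k + 2) - xb (k + 2)))\<^sup>2
        \<le> F (xb (k + 2)) - F (xb (Suc k + 2)) + (G * e (k + 2) + 2 * L * \<alpha> * G * e (k + 1))"
      by (simp add: mult_ac)
  next
    show "summable (\<lambda>k. G * e (k + 2) + 2 * L * \<alpha> * G * e (k + 1))"
      using e by (intro summable_add summable_mult summable_ignore_initial_segment)
  qed
  then have "summable (\<lambda>k. (norm (w (k + 2) - xb (k + 2)))\<^sup>2)"
    using c by simp
  then have "summable (\<lambda>k. 2 * (norm (w (k + 2) - xb (k + 2)))\<^sup>2 + 2 * suminf e * e (k + 2))"
    by (intro summable_add summable_mult summable_ignore_initial_segment[OF e])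
  \<comment> \<open>Split the step at \<open>w (k + 2)\<close> and use
    \<open>(a + b)\<^sup>2 \<le> 2 * a\<^sup>2 + 2 * b\<^sup>2\<close>; the square of
    \<open>e (k + 2)\<close> is summable because each term of \<open>e\<close> is at most
    \<open>suminf e\<close>.\<close>
  moreover have "norm ((norm (xbar x (k + 3) - xbar x (k + 3 - 1)))\<^sup>2)
      \<le> 2 * (norm (w (k + 2) - xb (k + 2)))\<^sup>2 + 2 * suminf e * e (k + 2)" for k
  proof -
    have "xbar x (k + 3) - xbar x (k + 3 - 1) = (xb (k + 3) - w (k + 2)) + (w (k + 2) - xb (k + 2))"
      by (simp add: xbar_eq_avg xb_def)
    then have "norm (xbar x (k + 3) - xbar x (k + 3 - 1)) \<le> e (k + 2) + norm (w (k + 2) - xb (k + 2))"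
      using norm_triangle_ineq[of "xb (k + 3) - w (k + 2)" "w (k + 2) - xb (k + 2)"] xb_w[of "k + 2"]
      by (simp add: numeral_3_eq_3)
    then have "(norm (xbar x (k + 3) - xbar x (k + 3 - 1)))\<^sup>2 \<le> (e (k + 2) + norm (w (k + 2) - xb (k + 2)))\<^sup>2"
      by (intro power_mono) auto
    also have "\<dots> \<le> 2 * (norm (w (k + 2) - xb (k + 2)))\<^sup>2 + 2 * (e (k + 2) * e (k + 2))"
      using sum_squares_bound[of "e (k + 2)" "norm (w (k + 2) - xb (k + 2))"]
      by (simp add: power2_eq_square algebra_simps)
    also have "e (k + 2) * e (k + 2) \<le> suminf e * e (k + 2)"
      using sum_le_suminf[OF e, of "{k + 2}"] e_nonneg by (intro mult_right_mono) auto
    finally show ?thesis by simp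
  qed
  ultimately have "summable (\<lambda>k. (norm (xbar x (k + 3) - xbar x (k + 3 - 1)))\<^sup>2)"
    by (rule summable_comparison_test'[where N = 0])
  then have b: "summable (\<lambda>k. (norm (xbar x k - xbar x (k - 1)))\<^sup>2)"
    by (subst (asm) summable_iff_shift[where f = "\<lambda>k. (norm (xbar x k - xbar x (k - 1)))\<^sup>2"])
  show ?thesis
  \<comment> \<open>The full series serves as the constant, for every \<open>T\<close>; at
    \<open>T = 0\<close> both sides vanish since \<open>1 / real 0 = 0\<close>.\<close>
  proof (intro bigoI always_eventually allI)
    fix T
    have "(\<Sum>k = 1..T. (norm (xbar x k - xbar x (k - 1)))\<^sup>2) \<le> (\<Sum>k. (norm (xbar x k - xbar x (k - 1)))\<^sup>2)"
      using b by (intro sum_le_suminf) auto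
    moreover have "0 \<le> (\<Sum>k = 1..T. (norm (xbar x k - xbar x (k - 1)))\<^sup>2)"
      by (intro sum_nonneg) auto
    ultimately show "norm (1 / real T * (\<Sum>k = 1..T. (norm (xbar x k - xbar x (k - 1)))\<^sup>2))
        \<le> (\<Sum>k. (norm (xbar x k - xbar x (k - 1)))\<^sup>2) * norm (1 / real T)"
      by (simp add: abs_mult divide_right_mono)
  qed
qed

end
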